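(* Let $d\geq 1$ be a natural number. If $G$ is a $d$-degenerate graph in which every connected component has even size, then the edge set of $G$ can be partitioned into $\lceil \log_2 (d+1) \rceil + 1$ bipartite subgraphs in each of which all connected components have even size.
   Context: All graphs are finite and simple. The size of a graph is its number of edges. A graph is $d$-degenerate if every subgraph has a vertex of degree at most $d$. *)

theory Defs
  imports Complex_Main "HOL-Library.Disjoint_Sets"
begin

record 'a graph =
  verts :: "'a set"
  edges :: "'a set set"

definition simple_graph :: "'a graph \<Rightarrow> bool" where
  "simple_graph G \<longleftrightarrow> finite (verts G) \<and> (\<forall>e\<in>edges G. e \<subseteq> verts G \<and> card e = 2)"

definition subgraph :: "'a graph \<Rightarrow> 'a graph \<Rightarrow> bool" where
  "subgraph H G \<longleftrightarrow> simple_graph H \<and> verts H \<subseteq> verts G \<and> edges H \<subseteq> edges G"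

definition graph_size :: "'a graph \<Rightarrow> nat" where
  "graph_size G = card (edges G)"

definition degree :: "'a graph \<Rightarrow> 'a \<Rightarrow> nat" where
  "degree G v = card {e \<in> edges G. v \<in> e}"

(* The null graph has no vertex at all, so it is excluded from the subgraphs considered. *)
definition degenerate :: "nat \<Rightarrow> 'a graph \<Rightarrow> bool" where
  "degenerate d G \<longleftrightarrow>
     (\<forall>H. subgraph H G \<and> verts H \<noteq> {} \<longrightarrow> (\<exists>v\<in>verts H. degree H v \<le> d))"

definition adjacency :: "'a graph \<Rightarrow> 'a rel" where
  "adjacency G = {(u, v). {u, v} \<in> edges G}"

definition connected_graph :: "'a graph \<Rightarrow> bool" where
  "connected_graph G \<longleftrightarrow>
     verts G \<noteq> {} \<and> (\<forall>u\<in>verts G. \<forall>v\<in>verts G. (u, v) \<in> (adjacency G)\<^sup>*)"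

definition component_of :: "'a graph \<Rightarrow> 'a graph \<Rightarrow> bool" where
  "component_of C G \<longleftrightarrow>
     subgraph C G \<and> connected_graph C \<and>
     (\<forall>H. subgraph H G \<and> connected_graph H \<and> subgraph C H \<longrightarrow> H = C)"

definition even_components :: "'a graph \<Rightarrow> bool" where
  "even_components G \<longleftrightarrow> (\<forall>C. component_of C G \<longrightarrow> even (graph_size C))"

definition bipartite :: "'a graph \<Rightarrow> bool" where
  "bipartite G \<longleftrightarrow>
     (\<exists>A B. A \<union> B = verts G \<and> A \<inter> B = {} \<and> (\<forall>e\<in>edges G. \<exists>a\<in>A. \<exists>b\<in>B. e = {a, b}))"

(* The k parts are indexed, and a part may have no edges: otherwise no edgeless graph,
   and no graph with fewer than k edges, would have such a partition. *)
definition edge_partition :: "'a graph \<Rightarrow> nat \<Rightarrow> (nat \<Rightarrow> 'a graph) \<Rightarrow> bool" where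
  "edge_partition G k H \<longleftrightarrow>
     (\<forall>i<k. subgraph (H i) G) \<and>
     disjoint_family_on (\<lambda>i. edges (H i)) {..<k} \<and>
     (\<Union>i<k. edges (H i)) = edges G"

end

theory Submission
  imports Defs
begin

text \<open>All components of a graph have even size iff each edge can be assigned to one of its ends
  so that every vertex receives evenly many edges, and such assignments of edge-disjoint graphs
  can be glued. Split the vertices into two sides such that each side induces a
  \<open>(d div 2)\<close>-degenerate graph and the crossing edges still connect every component; then the
  crossing edges admit an assignment with any odd set of the right parity on each component. Hence
  every component of odd size inside a side can be repaired by one crossing edge leaving it, with
  the remaining crossing edges forming one bipartite part with even components. The two sides are
  treated by induction, which halves \<open>d\<close> and uses one part. The repairing edges of the two sides
  are put into different parts: each inside component then has at most one of them in a part, and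
  recolouring that component keeps the part bipartite.\<close>

section \<open>Edge sets, connectivity, and assignments of edges to ends\<close>

text \<open>No vertex set is kept, so that edge sets can be united and subtracted freely; a vertex
  that no edge covers is connected only to itself.\<close>

definition conn :: "'a set set \<Rightarrow> 'a rel" where
  "conn W = {(u, v). {u, v} \<in> W}\<^sup>*"

definition edge_set :: "'a set set \<Rightarrow> bool" where
  "edge_set W \<longleftrightarrow> finite W \<and> (\<forall>e\<in>W. card e = 2)"

text \<open>\<open>R\<close> is the set of vertices that are assigned an odd number of edges.\<close>

definition orientable :: "'a set set \<Rightarrow> 'a set \<Rightarrow> bool" where
  "orientable W R \<longleftrightarrow>
     (\<exists>h. (\<forall>e\<in>W. h e \<in> e) \<and> {v. odd (card {e \<in> W. h e = v})} = R)"

text \<open>The normal form of a defect: in a finite graph, the parity set of an assignment that has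
  this form picks exactly one vertex from each component of odd size and none from the
  others.\<close>

definition separated :: "'a set set \<Rightarrow> 'a set \<Rightarrow> bool" where
  "separated W R \<longleftrightarrow> (\<forall>u\<in>R. \<forall>v\<in>R. (u, v) \<in> conn W \<longrightarrow> u = v)"

definition two_colourable :: "'a set set \<Rightarrow> bool" where
  "two_colourable W \<longleftrightarrow> (\<exists>f :: 'a \<Rightarrow> bool. \<forall>e\<in>W. \<exists>x\<in>e. \<exists>y\<in>e. f x \<noteq> f y)"

text \<open>Subgraphs are given by their edges alone, since one with an isolated vertex meets the
  degree condition anyway.\<close>

definition edge_degenerate :: "nat \<Rightarrow> 'a set set \<Rightarrow> bool" where
  "edge_degenerate d W \<longleftrightarrow>
     (\<forall>S\<subseteq>W. S \<noteq> {} \<longrightarrow> (\<exists>v\<in>\<Union>S. card {e \<in> S. v \<in> e} \<le> d))"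

definition inside :: "'a set set \<Rightarrow> ('a \<Rightarrow> bool) \<Rightarrow> 'a set set" where
  "inside W f = {e \<in> W. \<forall>x\<in>e. \<forall>y\<in>e. f x = f y}"

section \<open>Basic facts on connectivity and edge sets\<close>

lemma conn_refl [simp]: "(u, u) \<in> conn W"
  by (simp add: conn_def)

lemma conn_edge: "{u, v} \<in> W \<Longrightarrow> (u, v) \<in> conn W"
  by (auto simp: conn_def)

lemma conn_trans: "(u, v) \<in> conn W \<Longrightarrow> (v, w) \<in> conn W \<Longrightarrow> (u, w) \<in> conn W"
  unfolding conn_def by (rule rtrancl_trans)

lemma conn_sym: "(u, v) \<in> conn W \<Longrightarrow> (v, u) \<in> conn W"
proof -
  have "sym {(u, v). {u, v} \<in> W}"
    by (auto simp: sym_def insert_commute)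
  then show "(u, v) \<in> conn W \<Longrightarrow> (v, u) \<in> conn W"
    unfolding conn_def by (meson sym_rtrancl symD)
qed

lemma conn_mono: "V \<subseteq> W \<Longrightarrow> conn V \<subseteq> conn W"
  unfolding conn_def by (rule rtrancl_mono) auto

lemma conn_subset:
  assumes "\<And>u v. {u, v} \<in> V \<Longrightarrow> (u, v) \<in> conn W"
  shows "conn V \<subseteq> conn W"
proof -
  have "{(u, v). {u, v} \<in> V} \<subseteq> {(u, v). {u, v} \<in> W}\<^sup>*"
    using assms by (auto simp: conn_def)
  then show ?thesis
    unfolding conn_def by (rule rtrancl_subset_rtrancl)
qed

lemma separated_mono: "V \<subseteq> W \<Longrightarrow> separated W R \<Longrightarrow> separated V R"
  using conn_mono unfolding separated_def by blast

lemma edge_set_subset: "V \<subseteq> W \<Longrightarrow> edge_set W \<Longrightarrow> edge_set V"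
  by (auto simp: edge_set_def intro: finite_subset)

lemma edge_setE:
  assumes "edge_set W" "e \<in> W"
  obtains x y where "e = {x, y}" "x \<noteq> y"
  using assms by (auto simp: edge_set_def card_2_iff)

lemma edge_set_other:
  assumes "edge_set W" "e \<in> W" "x \<in> e"
  obtains y where "e = {x, y}" "x \<noteq> y"
  using edge_setE[OF assms(1,2)] assms(3) by (metis insertE insert_commute singletonD)

lemma edge_set_nonempty: "edge_set W \<Longrightarrow> e \<in> W \<Longrightarrow> \<exists>x. x \<in> e"
  by (erule edge_setE) auto

lemma finite_Union_edge_set: "edge_set W \<Longrightarrow> finite (\<Union>W)"
  unfolding edge_set_def by (metis card.infinite finite_Union zero_neq_numeral)

lemma edge_degenerate_mono: "V \<subseteq> W \<Longrightarrow> edge_degenerate d W \<Longrightarrow> edge_degenerate d V"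
  by (meson edge_degenerate_def subset_trans)

lemma edge_degenerate_0:
  assumes "edge_set W" "edge_degenerate 0 W"
  shows "W = {}"
proof (rule ccontr)
  assume "W \<noteq> {}"
  then obtain v where "v \<in> \<Union>W" "card {e \<in> W. v \<in> e} = 0"
    using assms(2) unfolding edge_degenerate_def by blast
  then show False
    using assms(1) by (auto simp: edge_set_def)
qed

section \<open>Parity sets of assignments\<close>

lemma orientable_subset_Union: "orientable W R \<Longrightarrow> R \<subseteq> \<Union>W"
proof
  fix v assume "orientable W R" "v \<in> R"
  then obtain h where h: "\<forall>e\<in>W. h e \<in> e" "odd (card {e \<in> W. h e = v})"
    by (auto simp: orientable_def)
  from h(2) have "{e \<in> W. h e = v} \<noteq> {}"
    by (metis card.empty even_zero)
  then show "v \<in> \<Union>W"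
    using h(1) by blast
qed

text \<open>At each vertex the two counts add, and addition of parities is symmetric
  difference.\<close>

lemma orientable_Un:
  assumes "finite A" "finite B" "A \<inter> B = {}" "orientable A R" "orientable B S"
  shows "orientable (A \<union> B) (sym_diff R S)"
proof -
  obtain g where g: "\<forall>e\<in>A. g e \<in> e" "{v. odd (card {e \<in> A. g e = v})} = R"
    using assms by (auto simp: orientable_def)
  obtain h where h: "\<forall>e\<in>B. h e \<in> e" "{v. odd (card {e \<in> B. h e = v})} = S"
    using assms by (auto simp: orientable_def)
  define k where "k e = (if e \<in> A then g e else h e)" for e
  have "card {e \<in> A \<union> B. k e = v} = card {e \<in> A. g e = v} + card {e \<in> B. h e = v}" for v
  proof -
    have "{e \<in> A \<union> B. k e = v} = {e \<in> A. g e = v} \<union> {e \<in> B. h e = v}"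
      using assms(3) by (auto simp: k_def)
    then show ?thesis
      using assms(1-3) by (auto intro!: card_Un_disjoint)
  qed
  then have "{v. odd (card {e \<in> A \<union> B. k e = v})} = sym_diff R S"
    using g(2) h(2) by auto
  moreover have "\<forall>e\<in>A \<union> B. k e \<in> e"
    using g(1) h(1) by (auto simp: k_def)
  ultimately show ?thesis
    unfolding orientable_def by blast
qed

text \<open>Reassigning the edge from its current end \<open>a\<close> to the other end
  \<open>b\<close> changes the two counts by one and no others.\<close>

lemma orientable_flip_edge:
  assumes "edge_set W" "orientable W R" "{u, v} \<in> W"
  shows "orientable W (sym_diff R {u, v})"
proof -
  have neq: "u \<noteq> v"
    using assms(1,3) by (auto simp: edge_set_def)
  have fin: "finite W"
    using assms(1) by (simp add: edge_set_def)
  obtain h where h: "\<forall>e\<in>W. h e \<in> e" "{x. odd (card {e \<in> W. h e = x})} = R"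
    using assms by (auto simp: orientable_def)
  define a where "a = h {u, v}"
  define b where "b = (if a = u then v else u)"
  have ab: "{u, v} = {a, b}" "a \<noteq> b"
    using h(1) assms(3) neq by (auto simp: a_def b_def)
  define g where "g = h({u, v} := b)"
  have 1: "{e \<in> W. h e = a} = insert {u, v} {e \<in> W. g e = a}" "{u, v} \<notin> {e \<in> W. g e = a}"
    using assms(3) ab(2) by (auto simp: g_def a_def)
  have 2: "{e \<in> W. g e = b} = insert {u, v} {e \<in> W. h e = b}" "{u, v} \<notin> {e \<in> W. h e = b}"
    using assms(3) ab(2) by (auto simp: g_def a_def)
  have 3: "{e \<in> W. g e = x} = {e \<in> W. h e = x}" if "x \<noteq> a" "x \<noteq> b" for x
    using that by (auto simp: g_def a_def)
  have "odd (card {e \<in> W. g e = x}) \<longleftrightarrow> (odd (card {e \<in> W. h e = x}) \<noteq> (x = a \<or> x = b))" for x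
    using 1 2 3 fin ab(2) by (cases "x = a"; cases "x = b") auto
  then have "{x. odd (card {e \<in> W. g e = x})} = sym_diff R {u, v}"
    using h(2) unfolding ab(1) by auto
  moreover have "\<forall>e\<in>W. g e \<in> e"
    using h(1) by (auto simp: g_def b_def)
  ultimately show ?thesis
    unfolding orientable_def by blast
qed

text \<open>Flip every edge of a walk from \<open>u\<close> to \<open>v\<close>: the changes at
  inner vertices cancel.\<close>

lemma orientable_flip_conn:
  assumes "edge_set W" "(u, v) \<in> conn W" "orientable W R" "u \<noteq> v"
  shows "orientable W (sym_diff R {u, v})"
proof -
  \<comment> \<open>The first disjunct covers a walk that returns to its start, where
    \<open>{u, v}\<close> would be a singleton and the flips cancel.\<close>
  have "u = v \<or> orientable W (sym_diff R {u, v})"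
    using assms(2) unfolding conn_def
  proof (induction rule: rtrancl_induct)
    case (step y z)
    then have yz: "{y, z} \<in> W"
      by simp
    show ?case
    proof (cases "u = y")
      case True
      then show ?thesis
        using orientable_flip_edge[OF assms(1,3) yz] by simp
    next
      case False
      then have "orientable W (sym_diff (sym_diff R {u, y}) {y, z})"
        using step.IH orientable_flip_edge[OF assms(1) _ yz] by blast
      moreover have "y \<noteq> z"
        using yz assms(1) by (auto simp: edge_set_def)
      ultimately show ?thesis
      proof (cases "u = z")
        case False
        with \<open>u \<noteq> y\<close> \<open>y \<noteq> z\<close> have "sym_diff (sym_diff R {u, y}) {y, z} = sym_diff R {u, z}"
          by auto
        with \<open>orientable W (sym_diff (sym_diff R {u, y}) {y, z})\<close> show ?thesis
          by simp
      qed simp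
    qed
  qed simp
  with assms(4) show ?thesis
    by simp
qed

text \<open>Double counting: \<open>K\<close> cuts no edge, so the edges within \<open>K\<close> are
  those assigned to vertices of \<open>K\<close>, and a sum has the parity of the number of its odd
  terms.\<close>

lemma orientable_parity:
  assumes "edge_set W" "orientable W R"
    and closed: "\<And>e. e \<in> W \<Longrightarrow> e \<inter> K \<noteq> {} \<Longrightarrow> e \<subseteq> K"
  shows "even (card {e \<in> W. e \<subseteq> K}) \<longleftrightarrow> even (card (R \<inter> K))"
proof -
  obtain h where h: "\<forall>e\<in>W. h e \<in> e" "{x. odd (card {e \<in> W. h e = x})} = R"
    using assms by (auto simp: orientable_def)
  \<comment> \<open>\<open>K\<close> may be infinite; the sum runs only over its covered
    vertices.\<close>
  define L where "L = K \<inter> \<Union>W"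
  have fin: "finite L" "finite W"
    using finite_Union_edge_set[OF assms(1)] assms(1) by (auto simp: L_def edge_set_def)
  have "{e \<in> W. e \<subseteq> K} = (\<Union>v\<in>L. {e \<in> W. h e = v})"
    using h(1) closed unfolding L_def by blast
  then have "card {e \<in> W. e \<subseteq> K} = (\<Sum>v\<in>L. card {e \<in> W. h e = v})"
    using fin by (simp add: card_UN_disjoint disjoint_iff)
  moreover have "{v \<in> L. odd (card {e \<in> W. h e = v})} = R \<inter> K"
    using h(2) orientable_subset_Union[OF assms(2)] by (auto simp: L_def)
  ultimately show ?thesis
    using even_sum_iff[OF fin(1), of "\<lambda>v. card {e \<in> W. h e = v}"] by simp
qed

lemma conn_class_closed:
  assumes "edge_set W" "e \<in> W" "e \<inter> {v. (r, v) \<in> conn W} \<noteq> {}"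
  shows "e \<subseteq> {v. (r, v) \<in> conn W}"
proof -
  obtain x where x: "x \<in> e" "(r, x) \<in> conn W"
    using assms(3) by blast
  obtain y where "e = {x, y}"
    using edge_set_other[OF assms(1,2) x(1)] by blast
  with x assms(2) show ?thesis
    using conn_trans[OF x(2) conn_edge] by auto
qed

lemma orientable_exists:
  assumes "edge_set W"
  shows "\<exists>R. orientable W R"
proof -
  have "\<forall>e\<in>W. \<exists>x. x \<in> e"
    using edge_set_nonempty[OF assms] by blast
  then have "\<forall>e\<in>W. (SOME x. x \<in> e) \<in> e"
    by (meson someI_ex)
  then have "orientable W {v. odd (card {e \<in> W. (SOME x. x \<in> e) = v})}"
    unfolding orientable_def by (intro exI[of _ "\<lambda>e. SOME x. x \<in> e"] conjI refl)
  then show ?thesis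
    by (rule exI)
qed

text \<open>Take \<open>Z\<close> with the least measure \<open>m\<close>. Two vertices of
  \<open>Z\<close> in one component could be flipped away; a vertex of \<open>Z\<close> in
  \<open>R\<close> could be traded for a neighbour, which lies outside \<open>R\<close> and
  \<open>Z\<close> because both are separated.\<close>

lemma orientable_separated:
  assumes W: "edge_set W" and R: "separated W R"
  shows "\<exists>Z. orientable W Z \<and> separated W Z \<and> Z \<inter> R = {}"
proof -
  define m where "m Z = card Z + card (Z \<inter> R)" for Z
  obtain Z where Z: "orientable W Z" and min: "\<And>Y. orientable W Y \<Longrightarrow> m Z \<le> m Y"
    using ex_has_least_nat[of "orientable W" _ m] orientable_exists[OF W] by blast
  have fin: "finite Y" if "orientable W Y" for Y
    using orientable_subset_Union[OF that] finite_Union_edge_set[OF W] finite_subset by blast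
  have "separated W Z"
    unfolding separated_def
  proof (intro ballI impI, rule ccontr)
    fix u v assume uv: "u \<in> Z" "v \<in> Z" "(u, v) \<in> conn W" "u \<noteq> v"
    have "orientable W (sym_diff Z {u, v})"
      by (rule orientable_flip_conn[OF W uv(3) Z uv(4)])
    moreover have "sym_diff Z {u, v} = Z - {u, v}"
      using uv by auto
    ultimately have "m Z \<le> m (Z - {u, v})"
      using min by simp
    moreover have "card (Z - {u, v}) < card Z"
      using uv fin[OF Z] by (intro psubset_card_mono) auto
    moreover have "card ((Z - {u, v}) \<inter> R) \<le> card (Z \<inter> R)"
      using fin[OF Z] by (intro card_mono) auto
    ultimately show False
      by (simp add: m_def)
  qed
  moreover have "Z \<inter> R = {}"
  proof (rule ccontr)
    assume "Z \<inter> R \<noteq> {}"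
    then obtain z where z: "z \<in> Z" "z \<in> R"
      by blast
    then obtain e where e: "e \<in> W" "z \<in> e"
      using orientable_subset_Union[OF Z] by blast
    obtain y where y: "e = {z, y}" "z \<noteq> y"
      using edge_set_other[OF W e] by blast
    then have c: "(z, y) \<in> conn W"
      using e(1) by (simp add: conn_edge)
    have yR: "y \<notin> R" and yZ: "y \<notin> Z"
      using c y(2) z R \<open>separated W Z\<close> by (auto simp: separated_def)
    have "orientable W (sym_diff Z {z, y})"
      by (rule orientable_flip_conn[OF W c Z y(2)])
    moreover have eq: "sym_diff Z {z, y} = insert y (Z - {z})"
      using z yZ y(2) by auto
    ultimately have "m Z \<le> m (insert y (Z - {z}))"
      using min by simp
    moreover have "card (insert y (Z - {z})) = card Z"
      using fin[OF Z] z(1) yZ card_Suc_Diff1[OF fin[OF Z] z(1)] by simp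
    moreover have "card (insert y (Z - {z}) \<inter> R) < card (Z \<inter> R)"
      using fin[OF Z] z yR by (intro psubset_card_mono) auto
    ultimately show False
      by (simp add: m_def)
  qed
  ultimately show ?thesis
    using Z by blast
qed

text \<open>On a connected graph only the parity of the number of edges restricts the parity set. As
  \<open>W - V\<close> has the same components as \<open>W\<close>, the assignment of
  \<open>W\<close> guarantees the right parity on each of them.\<close>

lemma orientable_diff:
  assumes W: "edge_set W" and V: "V \<subseteq> W"
    and orW: "orientable W R" and orV: "orientable V Z"
    and spanning: "conn W \<subseteq> conn (W - V)"
  shows "orientable (W - V) (sym_diff Z R)"
proof -
  let ?B = "W - V"
  have B: "edge_set ?B"
    by (rule edge_set_subset[OF _ W]) auto
  have fin: "finite (sym_diff T (sym_diff Z R))" if "orientable ?B T" for T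
  proof -
    have "sym_diff T (sym_diff Z R) \<subseteq> \<Union>W"
      using orientable_subset_Union[OF that] orientable_subset_Union[OF orW]
        orientable_subset_Union[OF orV] V by blast
    then show ?thesis
      using finite_Union_edge_set[OF W] finite_subset by blast
  qed
  \<comment> \<open>An assignment of \<open>W - V\<close> closest to the target is taken; its error
    \<open>Q\<close> then has at most one vertex per component, since a pair could be flipped
    away.\<close>
  define m where "m T = card (sym_diff T (sym_diff Z R))" for T
  obtain T where T: "orientable ?B T" and min: "\<And>Y. orientable ?B Y \<Longrightarrow> m T \<le> m Y"
    using ex_has_least_nat[of "orientable ?B" _ m] orientable_exists[OF B] by blast
  define Q where "Q = sym_diff T (sym_diff Z R)"
  have sep: "u = v" if uv: "u \<in> Q" "v \<in> Q" "(u, v) \<in> conn ?B" for u v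
  proof (rule ccontr)
    assume "u \<noteq> v"
    have "orientable ?B (sym_diff T {u, v})"
      by (rule orientable_flip_conn[OF B uv(3) T \<open>u \<noteq> v\<close>])
    then have "m T \<le> m (sym_diff T {u, v})"
      by (rule min)
    also have "sym_diff (sym_diff T {u, v}) (sym_diff Z R) = Q - {u, v}"
      using uv unfolding Q_def by auto
    then have "m (sym_diff T {u, v}) = card (Q - {u, v})"
      by (simp only: m_def)
    also have "\<dots> < card Q"
      using fin[OF T] uv unfolding Q_def[symmetric] by (intro psubset_card_mono) auto
    also have "card Q = m T"
      by (simp only: m_def Q_def)
    finally show False
      by simp
  qed
  have "Q = {}"
  proof (rule ccontr)
    assume "Q \<noteq> {}"
    then obtain q where q: "q \<in> Q"
      by blast
    define K where "K = {v. (q, v) \<in> conn W}"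
    have QK: "Q \<inter> K = {q}"
      using q sep spanning by (auto simp: K_def)
    \<comment> \<open>Together with \<open>V\<close> this assigns all of \<open>W\<close> with
      parity set \<open>sym_diff Q R\<close>. On the component \<open>K\<close> that set differs
      from \<open>R\<close> in \<open>q\<close> alone, against
      \<open>orientable_parity\<close>.\<close>
    have "orientable (?B \<union> V) (sym_diff T Z)"
      using W V T orV by (intro orientable_Un) (auto simp: edge_set_def intro: finite_subset)
    moreover have "?B \<union> V = W" "sym_diff T Z = sym_diff Q R"
      using V by (auto simp: Q_def)
    ultimately have orW2: "orientable W (sym_diff Q R)"
      by simp
    have closed: "\<And>e. e \<in> W \<Longrightarrow> e \<inter> K \<noteq> {} \<Longrightarrow> e \<subseteq> K"
      unfolding K_def by (rule conn_class_closed[OF W])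
    have "even (card (R \<inter> K)) \<longleftrightarrow> even (card (sym_diff Q R \<inter> K))"
      using orientable_parity[OF W orW closed] orientable_parity[OF W orW2 closed] by simp
    moreover have finR: "finite (R \<inter> K)"
      using orientable_subset_Union[OF orW] finite_Union_edge_set[OF W] finite_subset by blast
    moreover have "sym_diff Q R \<inter> K = (if q \<in> R then (R \<inter> K) - {q} else insert q (R \<inter> K))"
      using QK by auto
    moreover have "q \<in> K"
      by (simp add: K_def)
    ultimately show False
      by (cases "q \<in> R") (auto simp: card_Diff_singleton_if card_gt_0_iff)
  qed
  then have "T = sym_diff Z R"
    unfolding Q_def by blast
  with T show ?thesis
    by simp
qed

section \<open>Halving the degeneracy by splitting the vertices\<close>

lemma inside_subset: "inside W f \<subseteq> W"
  by (auto simp: inside_def)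

text \<open>Remove the edges at a vertex \<open>v\<close> of degree at most \<open>d\<close>, split
  the rest by induction, and put \<open>v\<close> on the side holding at most half of its
  neighbours. A set of inside edges either covers \<open>v\<close>, which then has low degree, or is
  a set of inside edges of the rest.\<close>

lemma degenerate_split:
  assumes "edge_set W" "edge_degenerate d W"
  shows "\<exists>f. edge_degenerate (d div 2) (inside W f)"
  using assms
proof (induction "card W" arbitrary: W rule: less_induct)
  case less
  have fin: "finite W"
    using less.prems by (simp add: edge_set_def)
  show ?case
  proof (cases "W = {}")
    case True
    then show ?thesis
      by (auto simp: edge_degenerate_def inside_def)
  next
    case False
    then obtain v where v: "v \<in> \<Union>W" "card {e \<in> W. v \<in> e} \<le> d"
      using less.prems unfolding edge_degenerate_def by blast
    define U where "U = {e \<in> W. v \<notin> e}"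
    have UW: "U \<subset> W"
      using v by (auto simp: U_def)
    then obtain f where f: "edge_degenerate (d div 2) (inside U f)"
      using less.hyps[OF psubset_card_mono[OF fin]] edge_set_subset edge_degenerate_mono less.prems
      by (metis psubset_imp_subset)
    \<comment> \<open>\<open>N b\<close> holds the edges that would become inside edges if
      \<open>v\<close> had colour \<open>b\<close>; the value of \<open>f\<close> at
      \<open>v\<close> itself is arbitrary and is skipped.\<close>
    define N where "N b = {e \<in> W. v \<in> e \<and> (\<forall>x\<in>e. x \<noteq> v \<longrightarrow> f x = b)}" for b
    have "N True \<inter> N False = {}"
    proof -
      have False if e: "e \<in> N True" "e \<in> N False" for e
      proof -
        obtain y where "e = {v, y}" "v \<noteq> y"
          using edge_set_other[OF less.prems(1), of e v] e(1) by (auto simp: N_def)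
        then show False
          using e by (simp add: N_def)
      qed
      then show ?thesis
        by blast
    qed
    moreover have "N True \<union> N False \<subseteq> {e \<in> W. v \<in> e}"
      by (auto simp: N_def)
    moreover have finN: "finite (N b)" for b
      using fin by (auto simp: N_def)
    ultimately have "card (N True) + card (N False) \<le> d"
      using v(2) fin card_mono[of "{e \<in> W. v \<in> e}" "N True \<union> N False"]
      by (simp add: card_Un_disjoint)
    then have "card (N True) \<le> d div 2 \<or> card (N False) \<le> d div 2"
      by linarith
    then obtain b where b: "card (N b) \<le> d div 2"
      by blast
    have "edge_degenerate (d div 2) (inside W (f(v := b)))"
      unfolding edge_degenerate_def
    proof (intro allI impI)
      fix S assume S: "S \<subseteq> inside W (f(v := b))" "S \<noteq> {}"
      show "\<exists>w\<in>\<Union>S. card {e \<in> S. w \<in> e} \<le> d div 2"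
      proof (cases "v \<in> \<Union>S")
        case True
        have "e \<in> N b" if e: "e \<in> S" "v \<in> e" for e
        proof -
          have "e \<in> W" and "\<forall>x\<in>e. (f(v := b)) x = (f(v := b)) v"
            using S(1) e unfolding inside_def by blast+
          moreover have "f x = b" if "x \<in> e" "x \<noteq> v" for x
            using bspec[OF calculation(2) that(1)] that(2) by simp
          ultimately show ?thesis
            using e(2) by (simp add: N_def)
        qed
        then have "{e \<in> S. v \<in> e} \<subseteq> N b"
          by blast
        then show ?thesis
          using True b card_mono[OF finN] le_trans by blast
      next
        case False
        have "e \<in> inside U f" if e: "e \<in> S" for e
        proof -
          have "v \<notin> e" "e \<in> W" and "\<forall>x\<in>e. \<forall>y\<in>e. (f(v := b)) x = (f(v := b)) y"
            using S(1) e False unfolding inside_def by blast+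
          moreover have "f x = f y" if xy: "x \<in> e" "y \<in> e" for x y
          proof -
            have "x \<noteq> v" "y \<noteq> v"
              using xy \<open>v \<notin> e\<close> by blast+
            with bspec[OF bspec[OF calculation(3) xy(1)] xy(2)] show ?thesis
              by simp
          qed
          ultimately show ?thesis
            unfolding inside_def U_def by blast
        qed
        then have "S \<subseteq> inside U f"
          by blast
        then show ?thesis
          using f S(2) unfolding edge_degenerate_def by blast
      qed
    qed
    then show ?thesis
      by blast
  qed
qed

text \<open>Swapping the two sides on one component of the crossing graph only turns inside edges
  into crossing ones, so a split with fewest inside edges has a spanning crossing graph.\<close>

lemma degenerate_spanning_split:
  assumes W: "edge_set W" and deg: "edge_degenerate d W"
  shows "\<exists>f. edge_degenerate (d div 2) (inside W f) \<and> conn W \<subseteq> conn (W - inside W f)"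
proof -
  define m where "m f = card (inside W f)" for f
  let ?P = "\<lambda>f. edge_degenerate (d div 2) (inside W f)"
  obtain f where f: "?P f" and min: "\<And>g. ?P g \<Longrightarrow> m f \<le> m g"
    using ex_has_least_nat[of ?P _ m] degenerate_split[OF W deg] by blast
  let ?B = "W - inside W f"
  have B: "edge_set ?B"
    by (rule edge_set_subset[OF _ W]) auto
  have "(u, v) \<in> conn ?B" if uv: "{u, v} \<in> W" for u v
  proof (rule ccontr)
    assume nc: "(u, v) \<notin> conn ?B"
    define K where "K = {x. (u, x) \<in> conn ?B}"
    define g where "g x = (f x \<noteq> (x \<in> K))" for x
    have sub: "inside W g \<subseteq> inside W f"
    proof
      fix e assume e: "e \<in> inside W g"
      show "e \<in> inside W f"
      proof (rule ccontr)
        assume "e \<notin> inside W f"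
        then have eB: "e \<in> ?B"
          using e inside_subset by blast
        \<comment> \<open>A crossing edge lies in \<open>K\<close> or misses it, so the swap changes
          both of its ends or neither.\<close>
        have "e \<subseteq> K \<or> e \<inter> K = {}"
          using conn_class_closed[OF B eB] unfolding K_def by blast
        then show False
          using e eB unfolding inside_def g_def by blast
      qed
    qed
    moreover have "{u, v} \<in> inside W f"
      using nc uv by (metis DiffI conn_edge)
    moreover have "{u, v} \<notin> inside W g"
    proof -
      have "f u = f v"
        using \<open>{u, v} \<in> inside W f\<close> unfolding inside_def by blast
      moreover have "u \<in> K" "v \<notin> K"
        using nc by (simp_all add: K_def)
      ultimately show ?thesis
        by (simp add: inside_def g_def)
    qed
    ultimately have "m g < m f"
      unfolding m_def using W finite_subset[OF inside_subset]
      by (intro psubset_card_mono) (auto simp: edge_set_def)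
    moreover have "?P g"
      by (rule edge_degenerate_mono[OF sub f])
    ultimately show False
      using min by fastforce
  qed
  then show ?thesis
    using f conn_subset by blast
qed

section \<open>Gluing two-colourings, and the induction on the number of parts\<close>

text \<open>Each component of \<open>W\<close> has at most one vertex of \<open>Z\<close>, hence at
  most one edge \<open>p z\<close> attached. If that edge is monochromatic, the colours of the whole
  component are swapped, while the other side keeps its colours. \<open>W\<close> is the whole of
  side \<open>b\<close>, of which \<open>S\<close> is only the share of one part.\<close>

lemma two_colourable_glue:
  fixes f :: "'a \<Rightarrow> bool"
  assumes W: "\<And>e x. e \<in> W \<Longrightarrow> x \<in> e \<Longrightarrow> f x = b"
    and S: "S \<subseteq> W" "edge_set S" "two_colourable S"
    and S': "\<And>e x. e \<in> S' \<Longrightarrow> x \<in> e \<Longrightarrow> f x \<noteq> b" "two_colourable S'"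
    and Z: "separated W Z" "\<And>z. z \<in> Z \<Longrightarrow> f z = b"
    and P: "\<And>z. z \<in> Z \<Longrightarrow> \<exists>a. p z = {z, a} \<and> f a \<noteq> b"
  shows "two_colourable (S \<union> S' \<union> p ` Z)"
proof -
  obtain g where g: "\<forall>e\<in>S. \<exists>x\<in>e. \<exists>y\<in>e. g x \<noteq> (g y :: bool)"
    using S(3) by (auto simp: two_colourable_def)
  obtain g' where g': "\<forall>e\<in>S'. \<exists>x\<in>e. \<exists>y\<in>e. g' x \<noteq> (g' y :: bool)"
    using S'(2) by (auto simp: two_colourable_def)
  obtain a where a: "\<And>z. z \<in> Z \<Longrightarrow> p z = {z, a z} \<and> f (a z) \<noteq> b"
    using P by metis
  \<comment> \<open>\<open>flip\<close> is constant on components of \<open>W\<close>, so edges of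
    \<open>S\<close> stay bichromatic; by separation \<open>z\<close> itself is the only witness
    that matters at \<open>z\<close>.\<close>
  define flip where "flip x \<longleftrightarrow> (\<exists>z\<in>Z. (x, z) \<in> conn W \<and> g z = g' (a z))" for x
  define h where "h x = (if f x = b then g x \<noteq> flip x else g' x)" for x
  have S_edge: "\<exists>x\<in>e. \<exists>y\<in>e. h x \<noteq> h y" if "e \<in> S" for e
  proof -
    obtain x y where xy: "x \<in> e" "y \<in> e" "g x \<noteq> g y"
      using bspec[OF g \<open>e \<in> S\<close>] by (elim bexE)
    then have "e = {x, y}"
      using edge_set_other[OF S(2) that xy(1)] by blast
    then have "(x, y) \<in> conn W"
      using that S(1) by (auto intro: conn_edge)
    then have "flip x = flip y"
      unfolding flip_def using conn_trans conn_sym by metis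
    moreover have "f x = b" "f y = b"
      using W that S(1) xy by blast+
    ultimately show ?thesis
      using xy by (intro bexI[of _ x] bexI[of _ y]) (auto simp: h_def)
  qed
  have S'_edge: "\<exists>x\<in>e. \<exists>y\<in>e. h x \<noteq> h y" if "e \<in> S'" for e
  proof -
    obtain x y where xy: "x \<in> e" "y \<in> e" "g' x \<noteq> g' y"
      using bspec[OF g' \<open>e \<in> S'\<close>] by (elim bexE)
    have "h x = g' x" "h y = g' y"
      using S'(1)[OF that xy(1)] S'(1)[OF that xy(2)] unfolding h_def by (simp_all only: if_False)
    with xy(3) have "h x \<noteq> h y"
      by simp
    with xy(1,2) show ?thesis
      by blast
  qed
  have "h z \<noteq> h (a z)" if "z \<in> Z" for z
  proof -
    have "flip z \<longleftrightarrow> g z = g' (a z)"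
      using Z(1) that unfolding flip_def separated_def by (metis conn_refl)
    then show ?thesis
      using a[OF that] Z(2)[OF that] by (auto simp: h_def)
  qed
  then have "\<exists>x\<in>e. \<exists>y\<in>e. h x \<noteq> h y" if "e \<in> p ` Z" for e
    using that a by blast
  with S_edge S'_edge show ?thesis
    unfolding two_colourable_def by (intro exI[of _ h] ballI) (elim UnE; simp)
qed

text \<open>The set \<open>R\<close> makes the induction possible: it marks the components of odd size, whose defect
  is confined to part 0, where the repairing edges are added.\<close>

lemma bipartite_even_colouring:
  assumes "edge_set W" "edge_degenerate d W" "d < 2 ^ k" "orientable W R" "separated W R"
  shows "\<exists>c. (\<forall>e\<in>W. c e \<le> k) \<and> (\<forall>j. two_colourable {e \<in> W. c e = j}) \<and>
    (\<forall>j. orientable {e \<in> W. c e = j} (if j = (0 :: nat) then R else {}))"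
  using assms
proof (induction k arbitrary: W d R)
  case 0
  \<comment> \<open>Here \<open>d < 1\<close>, so the graph is 0-degenerate and has no
    edges.\<close>
  then have "W = {}"
    using edge_degenerate_0 by simp
  moreover have "R = {}"
    using orientable_subset_Union[OF "0.prems"(4)] \<open>W = {}\<close> by simp
  ultimately show ?case
    by (simp add: two_colourable_def orientable_def)
next
  case (Suc k)
  note W = Suc.prems(1)
  obtain f where f: "edge_degenerate (d div 2) (inside W f)" "conn W \<subseteq> conn (W - inside W f)"
    using degenerate_spanning_split[OF Suc.prems(1,2)] by blast
  define V where "V b = {e \<in> W. \<forall>x\<in>e. f x = b}" for b
  note ne = edge_set_nonempty[OF W]
  have inside: "inside W f = V True \<union> V False"
  proof
    show "inside W f \<subseteq> V True \<union> V False"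
    proof
      fix e assume e: "e \<in> inside W f"
      then obtain x where "x \<in> e"
        using ne inside_subset by blast
      with e have "e \<in> V (f x)"
        unfolding inside_def V_def by blast
      then show "e \<in> V True \<union> V False"
        by (cases "f x") auto
    qed
    show "V True \<union> V False \<subseteq> inside W f"
      by (auto simp: inside_def V_def)
  qed
  have disj: "V True \<inter> V False = {}"
    using ne by (fastforce simp: V_def)
  have VW: "V b \<subseteq> W" for b
    by (auto simp: V_def)
  have V_edge_set: "edge_set (V b)" for b
    by (rule edge_set_subset[OF VW W])
  have V_deg: "edge_degenerate (d div 2) (V b)" for b
    by (rule edge_degenerate_mono[OF _ f(1)]) (cases b; simp add: inside)
  \<comment> \<open>One marker in each odd component of each side. Avoiding \<open>R\<close> ensures
    that the repairs and the defect \<open>R\<close> do not cancel at a vertex.\<close>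
  have "\<forall>b. \<exists>Z. orientable (V b) Z \<and> separated (V b) Z \<and> Z \<inter> R = {}"
    using orientable_separated[OF V_edge_set separated_mono[OF VW Suc.prems(5)]] by blast
  then obtain Z where Z: "\<And>b. orientable (V b) (Z b)" "\<And>b. separated (V b) (Z b)"
    "\<And>b. Z b \<inter> R = {}"
    by metis
  have Zf: "f z = b" if "z \<in> Z b" for z b
    using orientable_subset_Union[OF Z(1)] that by (auto simp: V_def)
  \<comment> \<open>Halving \<open>d\<close> pays for one part. \<open>Z b\<close> serves as the
    marking set of side \<open>b\<close>, whose defect thus sits in colour 0 there.\<close>
  have "d div 2 < 2 ^ k"
    using Suc.prems(3) by simp
  then have "\<forall>b. \<exists>c. (\<forall>e\<in>V b. c e \<le> k) \<and> (\<forall>j. two_colourable {e \<in> V b. c e = j}) \<and>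
    (\<forall>j. orientable {e \<in> V b. c e = j} (if j = (0 :: nat) then Z b else {}))"
    using Suc.IH[OF V_edge_set V_deg _ Z(1,2)] by blast
  from choice[OF this] obtain c where c':
    "\<forall>b. (\<forall>e\<in>V b. c b e \<le> k) \<and> (\<forall>j. two_colourable {e \<in> V b. c b e = j}) \<and>
      (\<forall>j. orientable {e \<in> V b. c b e = j} (if j = (0 :: nat) then Z b else {}))"
    by (elim exE)
  have c: "\<And>b e. e \<in> V b \<Longrightarrow> c b e \<le> k"
      "\<And>b j. two_colourable {e \<in> V b. c b e = j}"
      "\<And>b j. orientable {e \<in> V b. c b e = j} (if j = (0 :: nat) then Z b else {})"
    using c' by blast+
  \<comment> \<open>For \<open>k = 0\<close> the swap defined below would send colour 0 of the
    second side to part 2, beyond \<open>Suc k\<close>; both sides are edgeless in that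
    case.\<close>
  have V0: "V b = {}" if "k = 0" for b
    using edge_degenerate_0[OF V_edge_set] V_deg[of b] \<open>d div 2 < 2 ^ k\<close> that by simp
  have Z0: "Z b = {}" if "k = 0" for b
    using orientable_subset_Union[OF Z(1), of b] V0[OF that] by simp

  let ?B = "W - inside W f"
  let ?Z = "Z True \<union> Z False"
  have fin: "finite W"
    using W by (simp add: edge_set_def)
  \<comment> \<open>The crossing edges have to make up the difference between the inside edges and
    \<open>R\<close>. The two marker sets and \<open>R\<close> are pairwise disjoint, so this
    difference is their union.\<close>
  have "orientable (inside W f) (sym_diff (Z True) (Z False))"
    unfolding inside using fin finite_subset[OF VW] disj Z(1) by (intro orientable_Un) auto
  moreover have "sym_diff (Z True) (Z False) = ?Z"
    using Zf by blast
  ultimately have "orientable ?B (sym_diff ?Z R)"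
    using orientable_diff[OF W inside_subset Suc.prems(4) _ f(2)] by simp
  moreover have "sym_diff ?Z R = ?Z \<union> R"
    using Z(3) by blast
  ultimately obtain h where h: "\<forall>e\<in>?B. h e \<in> e" "{v. odd (card {e \<in> ?B. h e = v})} = ?Z \<union> R"
    by (auto simp: orientable_def)
  \<comment> \<open>An odd count is not zero, so some crossing edge is assigned to \<open>z\<close>;
    it becomes the repairing edge \<open>p z\<close>.\<close>
  have "\<exists>e\<in>?B. h e = z" if "z \<in> ?Z" for z
  proof -
    have "odd (card {e \<in> ?B. h e = z})"
      using h(2) that by blast
    then have "{e \<in> ?B. h e = z} \<noteq> {}"
      by (metis card.empty even_zero)
    then show ?thesis
      by blast
  qed
  then obtain p where p: "\<And>z. z \<in> ?Z \<Longrightarrow> p z \<in> ?B" "\<And>z. z \<in> ?Z \<Longrightarrow> h (p z) = z"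
    by metis
  \<comment> \<open>Taking away \<open>p z\<close> makes the count at \<open>z\<close> even and
    leaves the others alone; since the markers avoid \<open>R\<close>, the odd vertices left are
    exactly \<open>R\<close>.\<close>
  define F where "F = ?B - p ` ?Z"
  have finF: "finite F"
    using fin by (simp add: F_def)
  have "odd (card {e \<in> F. h e = v}) \<longleftrightarrow> v \<in> R" for v
  proof (cases "v \<in> ?Z")
    case True
    have "{e \<in> ?B. h e = v} = insert (p v) {e \<in> F. h e = v}" "p v \<notin> {e \<in> F. h e = v}"
      using p True by (auto simp: F_def)
    then have "card {e \<in> ?B. h e = v} = Suc (card {e \<in> F. h e = v})"
      using finF by simp
    moreover have "odd (card {e \<in> ?B. h e = v})"
      using h(2) True by blast
    moreover have "v \<notin> R"
      using True Z(3) by blast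
    ultimately show ?thesis
      by simp
  next
    case False
    then have "{e \<in> F. h e = v} = {e \<in> ?B. h e = v}"
      using p(2) by (auto simp: F_def)
    then show ?thesis
      using h(2) False by (metis (no_types, lifting) Un_iff mem_Collect_eq)
  qed
  then have orF: "orientable F R"
    using h(1) unfolding orientable_def F_def by blast
  have orP: "orientable (p ` Z b) (Z b)" for b
  proof -
    have sub: "Z b \<subseteq> ?Z"
      by (cases b) auto
    have "{e \<in> p ` Z b. h e = v} = (if v \<in> Z b then {p v} else {})" for v
      using sub p(2) by auto
    then have "{v. odd (card {e \<in> p ` Z b. h e = v})} = Z b"
      by auto
    moreover have "\<forall>e\<in>p ` Z b. h e \<in> e"
      using sub p(1) h(1) by blast
    ultimately show ?thesis
      unfolding orientable_def by blast
  qed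
  have p_edge: "\<exists>a. p z = {z, a} \<and> f a \<noteq> b" if "z \<in> Z b" for z b
  proof -
    have z: "z \<in> ?Z"
      using that by (cases b) auto
    then have "z \<in> p z" "p z \<in> W" "p z \<notin> inside W f"
      using p[OF z] h(1) by (metis, blast+)
    moreover obtain a where "p z = {z, a}"
      using edge_set_other[OF W \<open>p z \<in> W\<close> \<open>z \<in> p z\<close>] by blast
    ultimately show ?thesis
      using Zf[OF that] by (intro exI[of _ a]) (auto simp: inside_def)
  qed
  have pV: "p z \<notin> V b" if "z \<in> ?Z" for z b
    using p(1)[OF that] by (cases b) (auto simp: inside)

  text \<open>On the second side parts 0 and 1 are swapped, so that the repairing edges of the two sides
    go to different parts.\<close>
  define t where "t b i = (if b \<or> i > 1 then i else 1 - i)" for b and i :: nat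
  have tt: "t b (t b i) = i" for b i
    by (auto simp: t_def)
  \<comment> \<open>Part 0 is kept for the remaining crossing edges and the defect \<open>R\<close>,
    so the colours of the sides are shifted by one. Repairing edges join the part that contains the
    defect of their side, colour 0 before the swap.\<close>
  define C where "C e = (if e \<in> V True then Suc (t True (c True e))
    else if e \<in> V False then Suc (t False (c False e))
    else if e \<in> p ` Z True then Suc (t True 0)
    else if e \<in> p ` Z False then Suc (t False 0) else 0)" for e
  define S where "S b j = {e \<in> V b. c b e = t b j}" for b j
  \<comment> \<open>\<open>Y b j\<close> is the defect of \<open>S b j\<close>, which can be
    nonempty only where side \<open>b\<close> has its original colour 0.\<close>
  define Y where "Y b j = (if t b j = 0 then Z b else {})" for b j
  have part_0: "{e \<in> W. C e = 0} = F"
    by (auto simp: C_def F_def inside)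
  have t_iff: "t b i = j \<longleftrightarrow> i = t b j" for b i j
    using tt by metis
  have pZ: "p ` Z True \<inter> p ` Z False = {}"
  proof -
    have False if "x \<in> Z True" "y \<in> Z False" "p x = p y" for x y
    proof -
      have "h (p x) = x" "h (p y) = y"
        using p(2) that(1,2) by blast+
      then have "x = y"
        using that(3) by metis
      then show ?thesis
        using Zf[OF that(1)] Zf[OF that(2)] by blast
    qed
    then show ?thesis
      by blast
  qed
  have C_V: "C e = Suc (t b (c b e))" if "e \<in> V b" for e b
    using that disj by (cases b) (auto simp: C_def)
  have C_p: "C (p z) = Suc (t b 0)" if "z \<in> Z b" for z b
    using that pV pZ by (cases b) (auto simp: C_def)
  have part_Suc: "{e \<in> W. C e = Suc j} = (\<Union>b. S b j \<union> p ` Y b j)" for j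
  proof (intro equalityI subsetI)
    fix e assume "e \<in> {e \<in> W. C e = Suc j}"
    then have e: "C e = Suc j"
      by simp
    consider b where "e \<in> V b" | b z where "z \<in> Z b" "e = p z"
      using e unfolding C_def by (fastforce split: if_splits)
    then show "e \<in> (\<Union>b. S b j \<union> p ` Y b j)"
    proof cases
      case 1
      then show ?thesis
        using e C_V[OF 1] t_iff by (auto simp: S_def)
    next
      case 2
      then have "t b 0 = j"
        using e C_p by simp
      then have "t b j = 0"
        by (simp add: t_iff)
      then show ?thesis
        using 2 by (auto simp: Y_def)
    qed
  next
    fix e assume "e \<in> (\<Union>b. S b j \<union> p ` Y b j)"
    then obtain b where "e \<in> S b j \<union> p ` Y b j"
      by blast
    then show "e \<in> {e \<in> W. C e = Suc j}"
    proof
      assume "e \<in> S b j"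
      then show ?thesis
        using C_V VW tt by (auto simp: S_def)
    next
      assume "e \<in> p ` Y b j"
      then obtain z where z: "z \<in> Z b" "e = p z" "t b j = 0"
        by (auto simp: Y_def split: if_splits)
      then have "t b 0 = j"
        by (simp add: t_iff)
      moreover have "p z \<in> W"
        using p(1) z(1) by (cases b) auto
      ultimately show ?thesis
        using z C_p by simp
    qed
  qed
  \<comment> \<open>The inside edges and the repairing edges of a side have the same parity set in
    each part, so their sum vanishes.\<close>
  have orA: "orientable (S b j \<union> p ` Y b j) {}" for b j
  proof -
    have S: "orientable (S b j) (Y b j)"
      using c(3)[of b "t b j"] by (simp add: S_def Y_def)
    have P: "orientable (p ` Y b j) (Y b j)"
      using orP[of b] by (auto simp: Y_def orientable_def)
    have sub: "Y b j \<subseteq> ?Z"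
      by (cases b) (auto simp: Y_def)
    have "p ` Y b j \<subseteq> W" "S b j \<subseteq> W"
      using p(1) sub VW[of b] unfolding S_def by blast+
    then have "finite (p ` Y b j)" "finite (S b j)"
      using fin finite_subset by blast+
    moreover have "S b j \<inter> p ` Y b j = {}"
      using pV sub by (auto simp: S_def)
    ultimately show ?thesis
      using orientable_Un[OF _ _ _ S P] by simp
  qed
  have "orientable {e \<in> W. C e = j} (if j = 0 then R else {})" for j
  proof (cases j)
    case 0
    then show ?thesis
      using orF part_0 by simp
  next
    case (Suc i)
    have "(S True i \<union> p ` Y True i) \<inter> (S False i \<union> p ` Y False i) = {}"
    proof -
      have Y: "Y b i \<subseteq> Z b" for b
        by (auto simp: Y_def)
      have "S True i \<inter> S False i = {}"
        using disj by (auto simp: S_def)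
      moreover have "p ` Y True i \<inter> p ` Y False i = {}"
        using Int_mono[OF image_mono[OF Y] image_mono[OF Y], of p True p False]
        unfolding pZ by (rule subset_empty[THEN iffD1])
      moreover have "S b i \<inter> p ` Y b' i = {}" for b b'
      proof -
        have "e \<notin> S b i" if "e \<in> p ` Y b' i" for e
        proof -
          obtain z where "z \<in> Z b'" "e = p z"
            using \<open>e \<in> p ` Y b' i\<close> Y by blast
          moreover have "Z b' \<subseteq> ?Z"
            by (cases b') auto
          ultimately show ?thesis
            using pV[of z b] by (auto simp: S_def)
        qed
        then show ?thesis
          by blast
      qed
      ultimately show ?thesis
        by (simp add: Int_Un_distrib Int_Un_distrib2 Int_commute)
    qed
    moreover have "finite (S b i \<union> p ` Y b i)" for b
      using finite_subset[OF _ fin, of "S b i \<union> p ` Y b i"] part_Suc[of i] by blast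
    ultimately have "orientable ((S True i \<union> p ` Y True i) \<union> (S False i \<union> p ` Y False i)) {}"
      using orientable_Un[OF _ _ _ orA orA] by fastforce
    then show ?thesis
      using Suc part_Suc[of i] by (simp add: UNIV_bool Un_commute)
  qed
  moreover have "two_colourable {e \<in> W. C e = j}" for j
  proof (cases j)
    case 0
    have "\<exists>x\<in>e. \<exists>y\<in>e. f x \<noteq> f y" if "e \<in> F" for e
      using that by (auto simp: F_def inside_def)
    then show ?thesis
      using 0 part_0 unfolding two_colourable_def by auto
  next
    case (Suc i)
    \<comment> \<open>\<open>t True i\<close> and \<open>t False i\<close> are never both 0, so at
      least one side contributes no repairing edges to this part; \<open>b\<close> is chosen as the
      opposite of such a side.\<close>
    obtain b where b: "t (\<not> b) i \<noteq> 0"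
    proof (cases "i = 0")
      case True
      then show ?thesis
        using that[of True] by (simp add: t_def)
    next
      case False
      then show ?thesis
        using that[of False] by (simp add: t_def)
    qed
    have "two_colourable (S b i \<union> S (\<not> b) i \<union> p ` Y b i)"
    proof (rule two_colourable_glue[where W = "V b" and f = f and b = b])
      show "edge_set (S b i)"
        by (rule edge_set_subset[OF _ V_edge_set[of b]]) (auto simp: S_def)
      show "separated (V b) (Y b i)"
        using Z(2) by (auto simp: Y_def separated_def)
    qed (use c(2) Zf p_edge in \<open>auto simp: S_def V_def Y_def split: if_splits\<close>)
    moreover have "(\<Union>b. S b i \<union> p ` Y b i) = S b i \<union> S (\<not> b) i \<union> p ` Y b i"
      using b by (cases b) (auto simp: UNIV_bool Y_def)
    ultimately show ?thesis
      using Suc part_Suc by simp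
  qed
  moreover have "C e \<le> Suc k" if "e \<in> W" for e
  proof (cases "k = 0")
    case True
    then show ?thesis
      using V0 Z0 by (simp add: C_def)
  next
    case False
    have t_le: "t b i \<le> k" if "i \<le> k" for b i
      using that False by (auto simp: t_def)
    then show ?thesis
      using c(1) by (simp add: C_def)
  qed
  ultimately show ?case
    by blast
qed

section \<open>From graphs to edge sets and back\<close>

lemma edge_set_edges:
  assumes "simple_graph G"
  shows "edge_set (edges G)"
proof -
  have "edges G \<subseteq> Pow (verts G)" "finite (verts G)"
    using assms by (auto simp: simple_graph_def)
  then show ?thesis
    using assms finite_subset unfolding edge_set_def simple_graph_def by blast
qed

lemma rtrancl_adjacency: "(adjacency G)\<^sup>* = conn (edges G)"
  by (simp add: adjacency_def conn_def)

text \<open>In a separated parity set, a vertex \<open>r\<close> would be the only odd vertex of its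
  component, which would then have odd size.\<close>

lemma even_components_imp_orientable:
  assumes G: "simple_graph G" and even: "even_components G"
  shows "orientable (edges G) {}"
proof -
  let ?E = "edges G"
  have E: "edge_set ?E"
    by (rule edge_set_edges[OF G])
  obtain Z where Z: "orientable ?E Z" "separated ?E Z"
    using orientable_separated[OF E, of "{}"] by (auto simp: separated_def)
  have "Z = {}"
  proof (rule ccontr)
    assume "Z \<noteq> {}"
    then obtain r where r: "r \<in> Z"
      by blast
    define K where "K = {v. (r, v) \<in> conn ?E}"
    \<comment> \<open>The subgraph induced on the vertices reachable from \<open>r\<close>; the rest
      of the work is to show that it is a component in the sense of maximality.\<close>
    define C :: "'a graph" where "C = \<lparr>verts = K, edges = {e \<in> ?E. e \<subseteq> K}\<rparr>"
    have rK: "r \<in> K"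
      by (simp add: K_def)
    have rG: "r \<in> verts G"
      using orientable_subset_Union[OF Z(1)] r G by (auto simp: simple_graph_def)
    have KG: "K \<subseteq> verts G"
    proof
      fix v assume "v \<in> K"
      then have "(r, v) \<in> {(u, v). {u, v} \<in> ?E}\<^sup>*"
        by (simp add: K_def conn_def)
      then show "v \<in> verts G"
        using rG G by (induction rule: rtrancl_induct) (auto simp: simple_graph_def)
    qed
    \<comment> \<open>All vertices of a path from \<open>r\<close> lie in \<open>K\<close>, so its
      edges belong to \<open>C\<close>.\<close>
    have reach: "(r, v) \<in> conn (edges C)" if "v \<in> K" for v
    proof -
      have "(r, v) \<in> {(u, v). {u, v} \<in> ?E}\<^sup>*"
        using that by (simp add: K_def conn_def)
      then show ?thesis
      proof (induction rule: rtrancl_induct)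
        case (step y z)
        then have "(r, y) \<in> conn ?E" "{y, z} \<in> ?E"
          by (auto simp: conn_def)
        then have "{y, z} \<in> edges C"
          using conn_trans[OF \<open>(r, y) \<in> conn ?E\<close> conn_edge] by (simp add: C_def K_def)
        then show ?case
          by (rule conn_trans[OF step.IH conn_edge])
      qed simp
    qed
    have "component_of C G"
      unfolding component_of_def
    proof (intro conjI allI impI)
      show "subgraph C G"
        using G KG finite_subset by (auto simp: subgraph_def simple_graph_def C_def)
      show "connected_graph C"
        unfolding connected_graph_def rtrancl_adjacency
      proof (intro conjI ballI)
        show "verts C \<noteq> {}"
          using rK by (auto simp: C_def)
        fix u v assume "u \<in> verts C" "v \<in> verts C"
        then show "(u, v) \<in> conn (edges C)"
          using conn_trans[OF conn_sym[OF reach] reach] by (simp add: C_def)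
      qed
      fix H assume "subgraph H G \<and> connected_graph H \<and> subgraph C H"
      then have H: "subgraph H G" "connected_graph H" "subgraph C H"
        by auto
      have "verts H \<subseteq> K"
      proof
        fix v assume v: "v \<in> verts H"
        have "r \<in> verts H"
          using H(3) rK by (auto simp: subgraph_def C_def)
        then have "(r, v) \<in> conn (edges H)"
          using H(2) v unfolding connected_graph_def rtrancl_adjacency by blast
        then show "v \<in> K"
          using H(1) conn_mono unfolding subgraph_def K_def by blast
      qed
      then have "verts H = verts C"
        using H(3) by (auto simp: subgraph_def C_def)
      moreover have "edges H = edges C"
        using H(1,3) \<open>verts H \<subseteq> K\<close> unfolding subgraph_def simple_graph_def C_def by auto
      ultimately show "H = C"
        by simp
    qed
    then have "even (graph_size C)"
      using even by (simp add: even_components_def)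
    then have "even (card {e \<in> ?E. e \<subseteq> K})"
      by (simp add: graph_size_def C_def)
    moreover have "Z \<inter> K = {r}"
      using r rK Z(2) unfolding separated_def K_def by blast
    ultimately show False
      using orientable_parity[OF E Z(1) conn_class_closed[OF E, of _ r]] unfolding K_def by simp
  qed
  with Z show ?thesis
    by simp
qed

text \<open>By maximality no edge leaves a component and all edges on its vertices belong to it, so
  \<open>orientable_parity\<close> applies to its vertex set.\<close>

lemma orientable_imp_even_components:
  assumes G: "simple_graph G" and ori: "orientable (edges G) {}"
  shows "even_components G"
  unfolding even_components_def
proof (intro allI impI)
  fix C assume "component_of C G"
  then have C: "subgraph C G" "connected_graph C"
    and max: "\<And>H. subgraph H G \<Longrightarrow> connected_graph H \<Longrightarrow> subgraph C H \<Longrightarrow> H = C"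
    by (auto simp: component_of_def)
  have E: "edge_set (edges G)"
    by (rule edge_set_edges[OF G])
  have closed: "e \<subseteq> verts C \<and> e \<in> edges C" if e: "e \<in> edges G" "e \<inter> verts C \<noteq> {}" for e
  proof -
    obtain x where x: "x \<in> e" "x \<in> verts C"
      using e by blast
    obtain y where y: "e = {x, y}"
      using edge_set_other[OF E e(1) x(1)] by blast
    \<comment> \<open>Adding an edge that meets \<open>C\<close>, with its other end, keeps the
      graph connected; maximality forces the edge and that end to be in \<open>C\<close>
      already.\<close>
    define H :: "'a graph" where "H = \<lparr>verts = insert y (verts C), edges = insert e (edges C)\<rparr>"
    have reach: "(x, v) \<in> conn (edges H)" if "v \<in> verts H" for v
    proof (cases "v = y")
      case True
      then show ?thesis
        using y by (auto simp: H_def intro: conn_edge)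
    next
      case False
      then have "(x, v) \<in> conn (edges C)"
        using C(2) x(2) that unfolding connected_graph_def rtrancl_adjacency by (auto simp: H_def)
      moreover have "edges C \<subseteq> edges H"
        by (auto simp: H_def)
      ultimately show ?thesis
        using conn_mono by blast
    qed
    have "H = C"
    proof (rule max)
      show "subgraph H G"
        using C(1) G e(1) x(2) y by (auto simp: subgraph_def simple_graph_def H_def)
      show "connected_graph H"
        unfolding connected_graph_def rtrancl_adjacency
        using conn_trans[OF conn_sym[OF reach] reach] by (auto simp: H_def)
      show "subgraph C H"
        using C(1) by (auto simp: subgraph_def H_def)
    qed
    then have "insert y (verts C) = verts C" "insert e (edges C) = edges C"
      by (metis H_def graph.select_convs(1), metis H_def graph.select_convs(2))
    then show ?thesis
      using x(2) y by auto
  qed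
  have "edges C = {e \<in> edges G. e \<subseteq> verts C}"
  proof (intro equalityI subsetI)
    fix e assume "e \<in> {e \<in> edges G. e \<subseteq> verts C}"
    then have e: "e \<in> edges G" "e \<subseteq> verts C"
      by auto
    then have "e \<noteq> {}"
      using E by (auto simp: edge_set_def)
    then show "e \<in> edges C"
      using closed e by blast
  qed (use C(1) in \<open>auto simp: subgraph_def simple_graph_def\<close>)
  then show "even (graph_size C)"
    using orientable_parity[OF E ori, of "verts C"] closed by (simp add: graph_size_def)
qed

lemma degenerate_imp_edge_degenerate:
  assumes G: "simple_graph G" and deg: "degenerate d G"
  shows "edge_degenerate d (edges G)"
  unfolding edge_degenerate_def
proof (intro allI impI)
  fix S assume S: "S \<subseteq> edges G" "S \<noteq> {}"
  let ?H = "\<lparr>verts = \<Union>S, edges = S\<rparr>"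
  have S_edge_set: "edge_set S"
    by (rule edge_set_subset[OF S(1) edge_set_edges[OF G]])
  have "subgraph ?H G"
    using S(1) G finite_Union_edge_set[OF S_edge_set]
    by (auto simp: subgraph_def simple_graph_def)
  moreover have "\<Union>S \<noteq> {}"
    using S(2) S_edge_set by (fastforce simp: edge_set_def)
  ultimately have "\<exists>v\<in>verts ?H. degree ?H v \<le> d"
    using deg unfolding degenerate_def by (metis graph.select_convs(1))
  then show "\<exists>v\<in>\<Union>S. card {e \<in> S. v \<in> e} \<le> d"
    by (simp add: degree_def)
qed

lemma two_colourable_imp_bipartite:
  assumes G: "simple_graph G" and col: "two_colourable (edges G)"
  shows "bipartite G"
proof -
  obtain f where f: "\<forall>e\<in>edges G. \<exists>x\<in>e. \<exists>y\<in>e. f x \<noteq> (f y :: bool)"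
    using col by (auto simp: two_colourable_def)
  have "\<exists>a\<in>{v \<in> verts G. f v}. \<exists>b\<in>{v \<in> verts G. \<not> f v}. e = {a, b}" if e: "e \<in> edges G" for e
  proof -
    obtain a b where ab: "a \<in> e" "b \<in> e" "f a" "\<not> f b"
      using f e by blast
    moreover have "e = {a, b}"
      using edge_set_other[OF edge_set_edges[OF G] e ab(1)] ab by blast
    moreover have "e \<subseteq> verts G"
      using G e by (simp add: simple_graph_def)
    ultimately show ?thesis
      by blast
  qed
  then show ?thesis
    unfolding bipartite_def
    by (intro exI[of _ "{v \<in> verts G. f v}"] exI[of _ "{v \<in> verts G. \<not> f v}"]) auto
qed

theorem theorem20:
  fixes d :: nat and G :: "'a graph"
  assumes "d \<ge> 1"
    and "simple_graph G"
    and "degenerate d G"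
    and "even_components G"
  shows "\<exists>H. edge_partition G (nat \<lceil>log 2 (real d + 1)\<rceil> + 1) H \<and>
    (\<forall>i < nat \<lceil>log 2 (real d + 1)\<rceil> + 1. bipartite (H i) \<and> even_components (H i))"
proof -
  define k where "k = nat \<lceil>log 2 (real d + 1)\<rceil>"
  have "real d + 1 = 2 powr log 2 (real d + 1)"
    by simp
  also have "\<dots> \<le> 2 powr real k"
    unfolding k_def by (intro powr_mono real_nat_ceiling_ge) simp
  also have "\<dots> = real (2 ^ k)"
    by (simp add: powr_realpow)
  finally have d: "d < 2 ^ k"
    by linarith
  have sep: "separated (edges G) {}"
    by (simp add: separated_def)
  \<comment> \<open>With \<open>R = {}\<close> part 0 has no defect either; the trivial conditional
    only matches the form of the induction and is collapsed afterwards.\<close>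
  have "\<exists>c. (\<forall>e\<in>edges G. c e \<le> k) \<and> (\<forall>j. two_colourable {e \<in> edges G. c e = j}) \<and>
      (\<forall>j. orientable {e \<in> edges G. c e = j} (if j = (0 :: nat) then {} else {}))"
    by (rule bipartite_even_colouring[OF edge_set_edges[OF assms(2)]
          degenerate_imp_edge_degenerate[OF assms(2,3)] d
          even_components_imp_orientable[OF assms(2,4)] sep])
  then obtain c where c: "\<forall>e\<in>edges G. c e \<le> k"
      "\<And>j. two_colourable {e \<in> edges G. c e = j}"
      "\<And>j. orientable {e \<in> edges G. c e = (j :: nat)} {}"
    unfolding if_cancel by blast
  \<comment> \<open>Every part keeps all vertices; those isolated in it are components of size
    0.\<close>
  define H where "H i = \<lparr>verts = verts G, edges = {e \<in> edges G. c e = i}\<rparr>" for i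
  have simple: "simple_graph (H i)" for i
    using assms(2) by (auto simp: simple_graph_def H_def)
  \<comment> \<open>The colours run from 0 to \<open>k\<close>, which gives \<open>k + 1\<close>
    parts.\<close>
  have "edge_partition G (k + 1) H"
    unfolding edge_partition_def
  proof (intro conjI allI impI)
    show "subgraph (H i) G" for i
      using simple[of i] by (auto simp: subgraph_def H_def)
    show "disjoint_family_on (\<lambda>i. edges (H i)) {..<k + 1}"
      by (auto simp: disjoint_family_on_def H_def)
    show "(\<Union>i<k + 1. edges (H i)) = edges G"
      using c(1) by (auto simp: H_def less_Suc_eq_le)
  qed
  moreover have "bipartite (H i)" for i
    using two_colourable_imp_bipartite[OF simple] c(2) by (simp add: H_def)
  moreover have "even_components (H i)" for i
    using orientable_imp_even_components[OF simple] c(3) by (simp add: H_def)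
  ultimately show ?thesis
    unfolding k_def by blast
qed

end
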